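(* Let $\epsilon=(\epsilon_j)_{j\ge0}\in\{-1,1\}^{\mathbb N}$ and $P_q(z)=\frac1{\sqrt q}\sum_{j=0}^{q-1}\epsilon_jz^j$. Assume $(P_q)_{q\ge1}$ is square $L^2$-flat, i.e. $\int_{S^1}\big||P_q(z)|^2-1\big|^2dz\to0$ as $q\to\infty$. Let $X$ be the closure of the orbit of $\epsilon$ under the shift $S$ on $\{-1,1\}^{\mathbb N}$, $(Sx)_n=x_{n+1}$, and let $\mathbb P$ be any weak-* limit point of the empirical measures $\frac1N\sum_{j=1}^N\delta_{S^j\epsilon}$. Then the canonical coordinate projections $\pi_k(x)=x_k$, $k\ge0$, are pairwise independent random variables under $\mathbb P$.
   Context: $S^1$ is the unit circle with normalized Lebesgue measure $dz$; $\delta_x$ denotes the Dirac mass at $x$. *)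

theory Defs
  imports "HOL-Probability.Probability"
begin

definition circle_measure :: "complex measure" where
  "circle_measure = distr (uniform_measure lborel {0..<2 * pi}) (restrict_space borel (sphere 0 1)) cis"

definition sign_poly :: "(nat \<Rightarrow> real) \<Rightarrow> nat \<Rightarrow> complex \<Rightarrow> complex" where
  "sign_poly \<epsilon> q z = (1 / of_real (sqrt (real q))) * (\<Sum>j<q. of_real (\<epsilon> j) * z ^ j)"

definition square_L2_flat :: "(nat \<Rightarrow> complex \<Rightarrow> complex) \<Rightarrow> bool" where
  "square_L2_flat p \<longleftrightarrow>
     (\<lambda>q. LINT z|circle_measure. \<bar>(cmod (p q z))\<^sup>2 - 1\<bar>\<^sup>2) \<longlonglongrightarrow> 0"

definition left_shift :: "(nat \<Rightarrow> 'a) \<Rightarrow> nat \<Rightarrow> 'a" where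
  "left_shift x = (\<lambda>n. x (n + 1))"

text \<open>The closure is taken in the product topology on \<open>nat \<Rightarrow> real\<close>.  For a sequence with values
  in \<open>{-1, 1}\<close> it agrees with the closure in the subspace of all such sequences, because that
  subspace is closed.\<close>

definition orbit_closure :: "(nat \<Rightarrow> real) \<Rightarrow> (nat \<Rightarrow> real) set" where
  "orbit_closure \<epsilon> = closure (range (\<lambda>j. (left_shift ^^ j) \<epsilon>))"

definition borel_on :: "'a::topological_space set \<Rightarrow> 'a measure" where
  "borel_on X = restrict_space borel X"

definition empirical_measure :: "(nat \<Rightarrow> real) \<Rightarrow> nat \<Rightarrow> (nat \<Rightarrow> real) measure" where
  "empirical_measure \<epsilon> N =
     (let B = borel_on (orbit_closure \<epsilon>) in
      measure_of (space B) (sets B)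
        (\<lambda>A. (1 / of_nat N) * (\<Sum>j=1..N. emeasure (return B ((left_shift ^^ j) \<epsilon>)) A)))"

definition borel_probabilities :: "'a::topological_space set \<Rightarrow> 'a measure set" where
  "borel_probabilities X = {M. prob_space M \<and> sets M = sets (borel_on X)}"

text \<open>The coarsest topology on the Borel probability measures of a compact space \<open>X\<close> for which
  \<open>M \<mapsto> \<integral> f dM\<close> is continuous for every continuous \<open>f\<close> on \<open>X\<close>.  Probability measures form a
  weak-* closed subset of the dual of \<open>C(X)\<close>, so limit points of probability measures in that dual
  are the same as limit points here.\<close>

definition weak_star_topology :: "'a::topological_space set \<Rightarrow> 'a measure topology" where
  "weak_star_topology X =
     (let C = {f :: 'a \<Rightarrow> real. continuous_on X f} in
      pullback_topology (borel_probabilities X) (\<lambda>M. \<lambda>f\<in>C. LINT x|M. f x)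
        (product_topology (\<lambda>_. euclideanreal) C))"

text \<open>A limit point of the sequence, not of its set of values: a constant sequence has one.\<close>

definition seq_limit_point :: "'a topology \<Rightarrow> (nat \<Rightarrow> 'a) \<Rightarrow> 'a \<Rightarrow> bool" where
  "seq_limit_point T s p \<longleftrightarrow>
     p \<in> topspace T \<and> (\<forall>U. openin T U \<longrightarrow> p \<in> U \<longrightarrow> (\<exists>\<^sub>F n in sequentially. s n \<in> U))"

end

theory Submission
  imports Defs "HOL-Real_Asymp.Real_Asymp"
begin

text \<open>For \<open>d > 0\<close> the \<open>d\<close>-th Fourier coefficient of \<open>|P\<^sub>q|\<^sup>2 - 1\<close> is, up to complex conjugation, the correlation
  \<open>(1/q) \<Sum>\<^bsub>j<q-d\<^esub> \<epsilon>\<^sub>j \<epsilon>\<^bsub>j+d\<^esub>\<close>, so flatness makes all correlations of \<open>\<epsilon>\<close> vanish in the limit.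
  Hence the coordinates are orthonormal under \<open>\<mu>\<close>; they share a common mean, which by Bessel's
  inequality is 0.  Uncorrelated variables with two values are independent.\<close>

section \<open>Integration over the unit circle\<close>

lemma measurable_cis_circle:
  "cis \<in> uniform_measure lborel A \<rightarrow>\<^sub>M restrict_space borel (sphere 0 1)"
proof (rule measurable_restrict_space2)
  have [measurable]: "cis \<in> borel_measurable borel"
    by (intro borel_measurable_continuous_onI continuous_intros)
  show "cis \<in> borel_measurable (uniform_measure lborel A)"
    by measurable
qed simp

lemma prob_space_circle_measure: "prob_space circle_measure"
  and sets_circle_measure [measurable_cong]:
    "sets circle_measure = sets (restrict_space borel (sphere 0 1))"
  and space_circle_measure [simp]: "space circle_measure = sphere 0 1"
proof -
  interpret U: prob_space "uniform_measure lborel {0..<2 * pi}"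
    by (rule prob_space_uniform_measure) auto
  show "prob_space circle_measure"
    unfolding circle_measure_def by (intro U.prob_space_distr measurable_cis_circle)
  show "sets circle_measure = sets (restrict_space borel (sphere 0 1))"
    by (simp add: circle_measure_def)
  show "space circle_measure = sphere 0 1"
    by (simp add: circle_measure_def space_restrict_space)
qed

lemma measurable_circle_measure:
  fixes f :: "complex \<Rightarrow> 'b::topological_space"
  assumes "continuous_on UNIV f"
  shows "f \<in> borel_measurable circle_measure"
  using measurable_restrict_space1[OF borel_measurable_continuous_onI[OF assms]]
  by (simp add: measurable_cong_sets[OF sets_circle_measure refl])

lemma integrable_circle_measure:
  fixes f :: "complex \<Rightarrow> 'b::{banach, second_countable_topology}"
  assumes "continuous_on UNIV f"
  shows "integrable circle_measure f"
proof -
  interpret prob_space circle_measure by (rule prob_space_circle_measure)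
  have "compact (f ` sphere 0 1)"
    by (intro compact_continuous_image continuous_on_subset[OF assms]) auto
  then obtain B where "\<And>z. z \<in> sphere 0 1 \<Longrightarrow> norm (f z) \<le> B"
    by (force dest: compact_imp_bounded simp: bounded_iff)
  then show ?thesis
    by (intro integrable_const_bound[where B = B] AE_I2 measurable_circle_measure assms) simp
qed

text \<open>Pulling back along \<open>cis\<close> gives an integral over
  \<open>{0..<2 * pi}\<close>. The added endpoint is a null set, and the closed interval is what the
  fundamental theorem of calculus asks for.\<close>

lemma integral_circle_measure:
  fixes f :: "complex \<Rightarrow> complex"
  assumes "continuous_on UNIV f"
  shows "(LINT z|circle_measure. f z) = (LBINT t. indicator {0..2 * pi} t *\<^sub>R f (cis t)) / (2 * pi)"
proof -
  have f: "f \<in> borel_measurable (restrict_space borel (sphere 0 1))"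
    using measurable_circle_measure[OF assms] measurable_cong_sets[OF sets_circle_measure refl] by blast
  have [measurable]: "f \<in> borel_measurable borel" "cis \<in> borel_measurable borel"
    by (auto intro!: borel_measurable_continuous_onI continuous_intros assms)
  \<comment> \<open>A real-valued density, the form to which \<open>integral_density\<close>
    applies.\<close>
  have dens: "uniform_measure lborel {0..<2 * pi}
      = density lborel (\<lambda>t. ennreal (indicator {0..<2 * pi} t / (2 * pi)))"
    unfolding uniform_measure_def
    by (intro density_cong) (auto simp: indicator_def divide_ennreal[symmetric] ennreal_mult)
  have "(LINT z|circle_measure. f z) = (LINT t|uniform_measure lborel {0..<2 * pi}. f (cis t))"
    unfolding circle_measure_def by (rule integral_distr[OF measurable_cis_circle f])
  also have "\<dots> = (LBINT t. (indicator {0..<2 * pi} t / (2 * pi)) *\<^sub>R f (cis t))"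
    unfolding dens by (rule integral_density) (auto simp: indicator_def)
  also have "\<dots> = (LBINT t. (indicator {0..2 * pi} t *\<^sub>R f (cis t)) / (2 * pi))"
  proof (rule integral_cong_AE)
    show "AE t in lborel. (indicator {0..<2 * pi} t / (2 * pi)) *\<^sub>R f (cis t)
        = (indicator {0..2 * pi} t *\<^sub>R f (cis t)) / (2 * pi)"
      using AE_lborel_singleton[of "2 * pi"]
      by eventually_elim (auto simp: indicator_def scaleR_conv_of_real)
  qed auto
  also have "\<dots> = (LBINT t. indicator {0..2 * pi} t *\<^sub>R f (cis t)) / (2 * pi)"
    by simp
  finally show ?thesis .
qed

text \<open>On the circle \<open>cnj z\<close> is the inverse of \<open>z\<close>, so the integrand
  is 1 if \<open>a = b\<close>. Otherwise it is \<open>cis (k * t)\<close> with a nonzero integer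
  \<open>k\<close>, whose antiderivative takes the same value at both ends of a full period.\<close>

lemma integral_circle_measure_powers:
  "(LINT z|circle_measure. z ^ a * cnj z ^ b) = (if a = b then 1 else 0)"
proof (cases "a = b")
  case True
  interpret prob_space circle_measure by (rule prob_space_circle_measure)
  have "(LINT z|circle_measure. z ^ a * cnj z ^ b) = (LINT z|circle_measure. 1)"
  proof (rule Bochner_Integration.integral_cong[OF refl])
    fix z assume "z \<in> space circle_measure"
    then have "z * cnj z = 1"
      by (simp add: complex_norm_square[symmetric])
    then show "z ^ a * cnj z ^ b = 1"
      by (simp add: True power_mult_distrib[symmetric])
  qed
  then show ?thesis
    using True prob_space by simp
next
  case False
  define k where "k = real a - real b"
  have k: "k \<noteq> 0"
    using False by (simp add: k_def)
  have pow: "cis t ^ a * cnj (cis t) ^ b = cis (k * t)" for t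
    by (simp add: cis_cnj Complex.DeMoivre cis_mult k_def algebra_simps)
  have deriv: "((\<lambda>t. cis (k * t) / (\<i> * k)) has_vector_derivative cis (k * t)) (at t within S)" for t S
  proof -
    \<comment> \<open>The derivative is taken in the complex variable and then restricted to the
      real line.\<close>
    have "((\<lambda>w. exp (\<i> * k * w) / (\<i> * k)) has_field_derivative
        exp (\<i> * k * of_real t)) (at (of_real t))"
      using k by (auto intro!: derivative_eq_intros)
    then show ?thesis
      by (auto dest!: has_vector_derivative_real_field simp: cis_conv_exp mult.assoc)
  qed
  have "cis (k * (2 * pi)) = 1"
    using cis_multiple_2pi[of "of_int (int a - int b)"] by (simp add: k_def mult_ac)
  then have "(LBINT t. indicator {0..2 * pi} t *\<^sub>R cis (k * t)) = 0"
    by (subst integral_FTC_Icc[OF _ deriv]) (auto intro!: continuous_intros)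
  then show ?thesis
    using False by (subst integral_circle_measure) (auto intro!: continuous_intros simp: pow)
qed

section \<open>Fourier coefficients of \<open>|P_q|^2 - 1\<close> and correlations of the sign
  sequence\<close>

lemma of_real_cmod_sign_poly:
  "complex_of_real ((cmod (sign_poly \<epsilon> q z))\<^sup>2)
    = (\<Sum>j<q. \<Sum>l<q. of_real (\<epsilon> j * \<epsilon> l / q) * (z ^ j * cnj z ^ l))"
proof -
  have "complex_of_real ((cmod (sign_poly \<epsilon> q z))\<^sup>2) = sign_poly \<epsilon> q z * cnj (sign_poly \<epsilon> q z)"
    by (simp only: complex_norm_square)
  also have "\<dots> = (1 / of_real (sqrt q)) * (1 / of_real (sqrt q)) *
      ((\<Sum>j<q. of_real (\<epsilon> j) * z ^ j) * (\<Sum>l<q. of_real (\<epsilon> l) * cnj z ^ l))"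
    by (simp add: sign_poly_def)
  \<comment> \<open>This includes \<open>q = 0\<close>, where both sides are 0 because division by 0
    gives 0.\<close>
  also have "(1 / of_real (sqrt q)) * (1 / of_real (sqrt q)) = complex_of_real (1 / q)"
    by (simp flip: of_real_mult)
  also have "complex_of_real (1 / q) *
      ((\<Sum>j<q. of_real (\<epsilon> j) * z ^ j) * (\<Sum>l<q. of_real (\<epsilon> l) * cnj z ^ l))
      = (\<Sum>j<q. \<Sum>l<q. of_real (\<epsilon> j * \<epsilon> l / q) * (z ^ j * cnj z ^ l))"
    unfolding sum_product unfolding sum_distrib_left by (simp add: mult_ac)
  finally show ?thesis .
qed

text \<open>By orthogonality only the pairs with \<open>l = j + d\<close> survive, and the constant
  1 contributes nothing because \<open>d\<close> is nonzero. Truncated subtraction makes the sum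
  empty for \<open>q \<le> d\<close>. Integrating against \<open>z ^ d\<close> instead of its
  conjugate is harmless, since the coefficient is real.\<close>

lemma sign_poly_fourier_coefficient:
  assumes "d \<noteq> 0"
  shows "(LINT z|circle_measure. of_real ((cmod (sign_poly \<epsilon> q z))\<^sup>2 - 1) * z ^ d)
    = of_real ((\<Sum>j<q - d. \<epsilon> j * \<epsilon> (j + d)) / q)"
proof -
  let ?e = "\<lambda>a b z. z ^ a * cnj z ^ b :: complex"
  have int: "integrable circle_measure (?e a b)" for a b
    by (intro integrable_circle_measure continuous_intros)
  have "(LINT z|circle_measure. of_real ((cmod (sign_poly \<epsilon> q z))\<^sup>2 - 1) * z ^ d)
      = (LINT z|circle_measure.
          (\<Sum>j<q. \<Sum>l<q. of_real (\<epsilon> j * \<epsilon> l / q) * ?e (j + d) l z) - ?e d 0 z)"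
    unfolding of_real_diff of_real_cmod_sign_poly left_diff_distrib sum_distrib_right
    by (simp add: power_add mult_ac)
  also have "\<dots> = (\<Sum>j<q. \<Sum>l<q. of_real (\<epsilon> j * \<epsilon> l / q) * (LINT z|circle_measure. ?e (j + d) l z))
      - (LINT z|circle_measure. ?e d 0 z)"
    by (simp only: Bochner_Integration.integral_diff Bochner_Integration.integral_sum
        Bochner_Integration.integrable_sum integrable_mult_right int integral_mult_right_zero)
  also have "\<dots> = (\<Sum>j<q. \<Sum>l<q. of_real (\<epsilon> j * \<epsilon> l / q) * (if j + d = l then 1 else 0))"
    using assms by (simp only: integral_circle_measure_powers if_False diff_zero)
  also have "\<dots> = (\<Sum>j<q. if j + d < q then of_real (\<epsilon> j * \<epsilon> (j + d) / q) else 0)"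
    by (intro sum.cong) (auto simp: if_distrib[of "(*) _"] cong: if_cong)
  also have "\<dots> = (\<Sum>j<q - d. of_real (\<epsilon> j * \<epsilon> (j + d) / q))"
    \<comment> \<open>The indices \<open>j < q\<close> with \<open>j + d < q\<close> are exactly
      those below \<open>q - d\<close>.\<close>
    by (subst sum.inter_filter[symmetric]) (auto intro!: sum.cong)
  finally show ?thesis
    by (simp add: sum_divide_distrib)
qed

text \<open>The factor \<open>h\<close> is removed by the triangle inequality. What remains is
  Cauchy-Schwarz against the constant 1, obtained from the nonnegativity of the variance of
  \<open>\<bar>g x\<bar>\<close>.\<close>

lemma (in prob_space) cmod_expectation_mult_le:
  fixes g :: "'a \<Rightarrow> real" and h :: "'a \<Rightarrow> complex"
  assumes "integrable M g" "integrable M (\<lambda>x. (g x)\<^sup>2)" "\<And>x. x \<in> space M \<Longrightarrow> cmod (h x) \<le> 1"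
  shows "(cmod (expectation (\<lambda>x. of_real (g x) * h x)))\<^sup>2 \<le> expectation (\<lambda>x. (g x)\<^sup>2)"
proof -
  have "cmod (expectation (\<lambda>x. of_real (g x) * h x)) \<le> expectation (\<lambda>x. cmod (of_real (g x) * h x))"
    by (rule integral_norm_bound)
  also have "\<dots> \<le> expectation (\<lambda>x. \<bar>g x\<bar>)"
    using assms by (intro integral_mono') (auto simp: norm_mult intro: mult_left_le)
  finally have "(cmod (expectation (\<lambda>x. of_real (g x) * h x)))\<^sup>2 \<le> (expectation (\<lambda>x. \<bar>g x\<bar>))\<^sup>2"
    by (intro power_mono) auto
  also have "\<dots> \<le> expectation (\<lambda>x. (g x)\<^sup>2)"
    using variance_eq[of "\<lambda>x. \<bar>g x\<bar>"] variance_positive[of "\<lambda>x. \<bar>g x\<bar>"] assms(1,2) by simp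
  finally show ?thesis .
qed

text \<open>One Fourier coefficient is bounded by the L2 norm: \<open>z ^ d\<close> has modulus 1 on
  the circle.\<close>

lemma sign_poly_correlation_bound:
  assumes "d \<noteq> 0"
  shows "((\<Sum>j<q - d. \<epsilon> j * \<epsilon> (j + d)) / q)\<^sup>2
    \<le> (LINT z|circle_measure. \<bar>(cmod (sign_poly \<epsilon> q z))\<^sup>2 - 1\<bar>\<^sup>2)"
proof -
  interpret prob_space circle_measure by (rule prob_space_circle_measure)
  let ?g = "\<lambda>z. (cmod (sign_poly \<epsilon> q z))\<^sup>2 - 1"
  have cont: "continuous_on UNIV ?g"
    unfolding sign_poly_def by (intro continuous_intros)
  have "(cmod (expectation (\<lambda>z. of_real (?g z) * z ^ d)))\<^sup>2 \<le> expectation (\<lambda>z. (?g z)\<^sup>2)"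
  proof (rule cmod_expectation_mult_le)
    show "integrable circle_measure ?g" "integrable circle_measure (\<lambda>z. (?g z)\<^sup>2)"
      by (rule integrable_circle_measure continuous_on_power cont)+
  qed (simp add: norm_power)
  then show ?thesis
    unfolding sign_poly_fourier_coefficient[OF assms] norm_of_real by (simp add: power_divide)
qed

lemma flat_correlation_tendsto:
  assumes "square_L2_flat (sign_poly \<epsilon>)" "d \<noteq> 0"
  shows "(\<lambda>q. (\<Sum>j<q - d. \<epsilon> j * \<epsilon> (j + d)) / q) \<longlonglongrightarrow> 0"
proof -
  have "(\<lambda>q. ((\<Sum>j<q - d. \<epsilon> j * \<epsilon> (j + d)) / q)\<^sup>2) \<longlonglongrightarrow> 0"
  proof (rule Lim_null_comparison)
    show "(\<lambda>q. LINT z|circle_measure. \<bar>(cmod (sign_poly \<epsilon> q z))\<^sup>2 - 1\<bar>\<^sup>2) \<longlonglongrightarrow> 0"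
      using assms(1) unfolding square_L2_flat_def .
    show "\<forall>\<^sub>F q in sequentially. norm (((\<Sum>j<q - d. \<epsilon> j * \<epsilon> (j + d)) / q)\<^sup>2)
        \<le> (LINT z|circle_measure. \<bar>(cmod (sign_poly \<epsilon> q z))\<^sup>2 - 1\<bar>\<^sup>2)"
      using sign_poly_correlation_bound[OF assms(2)]
      by (intro always_eventually allI) (simp only: real_norm_def abs_power2)
  qed
  then show ?thesis
    by simp
qed

section \<open>The orbit closure and the empirical measures\<close>

lemma left_shift_funpow: "(left_shift ^^ j) x n = x (n + j)"
  by (induction j arbitrary: n) (auto simp: left_shift_def)

lemma orbit_in_orbit_closure: "(left_shift ^^ j) \<epsilon> \<in> orbit_closure \<epsilon>"
  unfolding orbit_closure_def by (rule subsetD[OF closure_subset]) auto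

text \<open>The condition on coordinate \<open>i\<close> cuts out a closed set, as the preimage of a
  closed set under a continuous projection, and this set contains the orbit.\<close>

lemma orbit_closure_values:
  assumes "\<And>j. \<epsilon> j \<in> {-1, 1 :: real}" "x \<in> orbit_closure \<epsilon>"
  shows "x i \<in> {-1, 1}"
proof -
  have "closed ((\<lambda>x :: nat \<Rightarrow> real. x i) -` {-1, 1})"
    by (intro closed_vimage continuous_on_product_coordinates) simp
  moreover have "range (\<lambda>j. (left_shift ^^ j) \<epsilon>) \<subseteq> (\<lambda>x. x i) -` {-1, 1}"
    using assms(1) by (auto simp: left_shift_funpow)
  ultimately have "orbit_closure \<epsilon> \<subseteq> (\<lambda>x. x i) -` {-1, 1}"
    unfolding orbit_closure_def by (intro closure_minimal)
  then show ?thesis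
    using assms(2) by blast
qed

lemma measurable_orbit:
  "(\<lambda>j. (left_shift ^^ j) \<epsilon>) \<in> uniform_count_measure A \<rightarrow>\<^sub>M borel_on (orbit_closure \<epsilon>)"
  by (auto simp: measurable_def borel_on_def space_restrict_space orbit_in_orbit_closure
      sets_uniform_count_measure space_uniform_count_measure)

text \<open>The empirical measure is the law of the orbit point at a uniformly chosen time in
  \<open>{1..N}\<close>. In this form its integrals become finite averages.\<close>

lemma empirical_measure_distr:
  assumes "N > 0"
  shows "empirical_measure \<epsilon> N = distr (uniform_count_measure {1..N})
    (borel_on (orbit_closure \<epsilon>)) (\<lambda>j. (left_shift ^^ j) \<epsilon>)"
proof -
  define B where "B = borel_on (orbit_closure \<epsilon>)"
  let ?D = "distr (uniform_count_measure {1..N}) B (\<lambda>j. (left_shift ^^ j) \<epsilon>)"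
  note meas = measurable_orbit[of \<epsilon> "{1..N}", folded B_def]
  have "(1 / of_nat N) * (\<Sum>j=1..N. emeasure (return B ((left_shift ^^ j) \<epsilon>)) A) = emeasure ?D A"
    if "A \<in> sets B" for A
  proof -
    have "emeasure ?D A = ennreal (card {j\<in>{1..N}. (left_shift ^^ j) \<epsilon> \<in> A} / N)"
    proof -
      have "(\<lambda>j. (left_shift ^^ j) \<epsilon>) -` A \<inter> space (uniform_count_measure {1..N})
          = {j\<in>{1..N}. (left_shift ^^ j) \<epsilon> \<in> A}"
        by (auto simp: space_uniform_count_measure)
      then show ?thesis
        by (simp only: emeasure_distr[OF meas that])
          (subst emeasure_uniform_count_measure, auto)
    qed
    also have "\<dots> = (1 / of_nat N) * of_nat (card {j\<in>{1..N}. (left_shift ^^ j) \<epsilon> \<in> A})"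
      using assms by (simp add: ennreal_of_nat_eq_real_of_nat mult.commute[of "1 / _"]
          ennreal_times_divide divide_ennreal)
    also have "of_nat (card {j\<in>{1..N}. (left_shift ^^ j) \<epsilon> \<in> A})
        = (\<Sum>j=1..N. emeasure (return B ((left_shift ^^ j) \<epsilon>)) A)"
      using that by (simp add: indicator_def sum.If_cases Int_def)
    finally show ?thesis
      by simp
  qed
  \<comment> \<open>\<open>measure_of\<close> depends only on the values on the sigma-algebra, so
    the explicit set function can be exchanged for one already known to be a measure.\<close>
  then have "empirical_measure \<epsilon> N = measure_of (space B) (sets B) (emeasure ?D)"
    unfolding empirical_measure_def Let_def B_def[symmetric]
    by (intro measure_of_eq sets.space_closed) (simp add: sets.sigma_sets_eq)
  also have "\<dots> = ?D"
    using measure_of_of_measure[of ?D] by simp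
  finally show ?thesis
    unfolding B_def .
qed

lemma integral_empirical_measure:
  fixes f :: "(nat \<Rightarrow> real) \<Rightarrow> real"
  assumes "N > 0" "continuous_on (orbit_closure \<epsilon>) f"
  shows "(LINT x|empirical_measure \<epsilon> N. f x) = (\<Sum>j=1..N. f ((left_shift ^^ j) \<epsilon>)) / N"
proof -
  have "f \<in> borel_measurable (borel_on (orbit_closure \<epsilon>))"
    using assms(2) unfolding borel_on_def by (rule borel_measurable_continuous_on_restrict)
  then show ?thesis
    unfolding empirical_measure_distr[OF assms(1)]
    by (simp add: integral_distr[OF measurable_orbit] integral_uniform_count_measure)
qed

section \<open>Limit points in the weak-* topology\<close>

text \<open>The topology is pulled back from a product indexed by the continuous functions;
  integration of \<open>f\<close> is the projection to the factor \<open>f\<close>.\<close>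

lemma continuous_map_weak_star_integral:
  fixes f :: "'a::topological_space \<Rightarrow> real"
  assumes "continuous_on X f"
  shows "continuous_map (weak_star_topology X) euclideanreal (\<lambda>M. LINT x|M. f x)"
proof -
  let ?C = "{f :: 'a \<Rightarrow> real. continuous_on X f}"
  have "continuous_map (product_topology (\<lambda>_. euclideanreal) ?C) euclideanreal (\<lambda>F. F f)"
    using assms by (intro continuous_map_product_projection) auto
  from continuous_map_pullback[OF this, of "borel_probabilities X" "\<lambda>M. \<lambda>f\<in>?C. LINT x|M. f x"] show ?thesis
    using assms by (simp add: weak_star_topology_def Let_def comp_def)
qed

text \<open>If \<open>g p\<close> and \<open>l\<close> differed, disjoint neighbourhoods would
  separate them: \<open>g (s n)\<close> would lie frequently in one and eventually in the
  other.\<close>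

lemma seq_limit_point_continuous_map:
  assumes "seq_limit_point T s p" "continuous_map T euclideanreal g" "(\<lambda>n. g (s n)) \<longlonglongrightarrow> l"
  shows "g p = l"
proof (rule ccontr)
  assume "g p \<noteq> l"
  from hausdorff[OF this] obtain U V where UV: "open U" "open V" "g p \<in> U" "l \<in> V" "U \<inter> V = {}"
    by blast
  have "openin T {x \<in> topspace T. g x \<in> U}"
    using assms(2) UV(1) by (auto simp: continuous_map_def)
  then have "\<exists>\<^sub>F n in sequentially. g (s n) \<in> U"
    using assms(1) UV(3) unfolding seq_limit_point_def by (auto elim!: frequently_elim1)
  moreover have "\<forall>\<^sub>F n in sequentially. g (s n) \<in> V"
    using assms(3) UV by (auto dest: topological_tendstoD)
  ultimately have "\<exists>\<^sub>F n in sequentially. g (s n) \<in> V \<and> g (s n) \<in> U"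
    by (rule frequently_eventually_conj)
  then show False
    using UV(5) by (auto dest: frequently_ex)
qed

text \<open>This turns convergent averages along the orbit into exact integrals under the limit
  point.\<close>

lemma integral_empirical_limit:
  fixes f :: "(nat \<Rightarrow> real) \<Rightarrow> real"
  assumes "seq_limit_point (weak_star_topology (orbit_closure \<epsilon>)) (empirical_measure \<epsilon>) \<mu>"
    and "continuous_on UNIV f"
    and "(\<lambda>N. (\<Sum>j=1..N. f ((left_shift ^^ j) \<epsilon>)) / N) \<longlonglongrightarrow> l"
  shows "(LINT x|\<mu>. f x) = l"
proof (rule seq_limit_point_continuous_map[OF assms(1)])
  have f: "continuous_on (orbit_closure \<epsilon>) f"
    using assms(2) by (rule continuous_on_subset) auto
  then show "continuous_map (weak_star_topology (orbit_closure \<epsilon>)) euclideanreal (\<lambda>M. LINT x|M. f x)"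
    by (rule continuous_map_weak_star_integral)
  \<comment> \<open>The average formula for the empirical measure is available for
    \<open>N > 0\<close>, hence eventually.\<close>
  have "\<forall>\<^sub>F N in sequentially. (\<Sum>j=1..N. f ((left_shift ^^ j) \<epsilon>)) / N = (LINT x|empirical_measure \<epsilon> N. f x)"
    using eventually_gt_at_top[of 0] by eventually_elim (simp add: integral_empirical_measure[OF _ f])
  then show "(\<lambda>N. LINT x|empirical_measure \<epsilon> N. f x) \<longlonglongrightarrow> l"
    using assms(3) by (rule Lim_transform_eventually[rotated])
qed

section \<open>Averages of correlations and of shifts along the orbit\<close>

text \<open>The average runs over a window of the lag \<open>k - i\<close> correlation sum, so it is
  a difference of two partial sums: flatness controls the first, and the second does not depend on
  \<open>N\<close>.\<close>

lemma flat_shifted_correlation_tendsto: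
  assumes "\<And>j. \<epsilon> j \<in> {-1, 1}" "square_L2_flat (sign_poly \<epsilon>)" "i < k"
  shows "(\<lambda>N. (\<Sum>j=1..N. \<epsilon> (i + j) * \<epsilon> (k + j)) / N) \<longlonglongrightarrow> 0"
proof -
  define d where "d = k - i"
  have d: "d \<noteq> 0" "k = i + d"
    using assms(3) by (auto simp: d_def)
  define S where "S n = (\<Sum>j<n. \<epsilon> j * \<epsilon> (j + d))" for n
  have sum_eq: "(\<Sum>j=1..N. \<epsilon> (i + j) * \<epsilon> (k + j)) = S (N + k + 1 - d) - S (i + 1)" for N
  proof -
    have "(\<Sum>j=1..N. \<epsilon> (i + j) * \<epsilon> (k + j)) = (\<Sum>j=1 + i..N + i. \<epsilon> j * \<epsilon> (j + d))"
      unfolding sum.shift_bounds_cl_nat_ivl d(2) by (simp add: add_ac)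
    also have "\<dots> = (\<Sum>j\<in>{..<N + i + 1} - {..<i + 1}. \<epsilon> j * \<epsilon> (j + d))"
      by (rule sum.cong) auto
    also have "\<dots> = S (N + i + 1) - S (i + 1)"
      unfolding S_def by (rule sum_diff) auto
    finally show ?thesis
      by (simp add: d(2))
  qed
  have "(\<lambda>q. S (q - d) / q) \<longlonglongrightarrow> 0"
    unfolding S_def by (rule flat_correlation_tendsto[OF assms(2) d(1)])
  \<comment> \<open>With \<open>q = N + k + 1\<close> the index \<open>q - d\<close> is
    \<open>N + i + 1\<close>, the end of the window. Normalizing by \<open>N\<close> instead of
    \<open>q\<close> costs a factor tending to 1.\<close>
  then have "(\<lambda>N. S (N + (k + 1) - d) / (N + (k + 1) :: nat)) \<longlonglongrightarrow> 0"
    by (rule LIMSEQ_ignore_initial_segment)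
  moreover have "(\<lambda>N. real (N + (k + 1)) / real N) \<longlonglongrightarrow> 1"
    by real_asymp
  ultimately have "(\<lambda>N. S (N + (k + 1) - d) / (N + (k + 1) :: nat) * (real (N + (k + 1)) / real N)
      - S (i + 1) / real N) \<longlonglongrightarrow> 0 * 1 - 0"
    by (intro tendsto_intros lim_const_over_n)
  then show ?thesis
    unfolding sum_eq by (simp add: diff_divide_distrib del: of_nat_add of_nat_Suc)
qed

text \<open>The sum telescopes to two boundary terms, each of modulus 1. Averaging the difference
  avoids any claim that the separate averages converge.\<close>

lemma shift_average_tendsto:
  assumes "\<And>j. \<epsilon> j \<in> {-1, 1 :: real}"
  shows "(\<lambda>N. (\<Sum>j=1..N. \<epsilon> (i + j) - \<epsilon> (Suc i + j)) / N) \<longlonglongrightarrow> 0"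
proof (rule Lim_null_comparison)
  have telescope: "(\<Sum>j=1..N. \<epsilon> (i + j) - \<epsilon> (Suc i + j)) = \<epsilon> (i + 1) - \<epsilon> (i + N + 1)" for N
    by (induction N) auto
  have "\<bar>\<epsilon> j\<bar> = 1" for j
    using assms[of j] by auto
  then have "\<bar>\<epsilon> (i + 1) - \<epsilon> (i + N + 1)\<bar> \<le> 2" for N
    using abs_triangle_ineq4[of "\<epsilon> (i + 1)" "\<epsilon> (i + N + 1)"] by simp
  then show "\<forall>\<^sub>F N in sequentially.
      norm ((\<Sum>j=1..N. \<epsilon> (i + j) - \<epsilon> (Suc i + j)) / N) \<le> 2 / real N"
    unfolding telescope by (intro always_eventually allI) (auto intro: divide_right_mono)
  show "(\<lambda>N. 2 / real N) \<longlonglongrightarrow> 0"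
    by (rule lim_const_over_n)
qed

section \<open>Orthonormal sequences and sign-valued random variables\<close>

text \<open>Bessel's inequality for the constant function 1: its coefficients \<open>m\<close> along the
  orthonormal sequence \<open>X\<close> satisfy \<open>n m\<^sup>2 \<le> 1\<close> for every \<open>n\<close>.\<close>

lemma (in prob_space) orthonormal_common_mean_zero:
  fixes X :: "nat \<Rightarrow> 'a \<Rightarrow> real"
  assumes int: "\<And>i. integrable M (X i)" "\<And>i k. integrable M (\<lambda>x. X i x * X k x)"
    and orth: "\<And>i k. expectation (\<lambda>x. X i x * X k x) = (if i = k then 1 else 0)"
    and mean: "\<And>i. expectation (X i) = m"
  shows "m = 0"
proof (rule ccontr)
  assume "m \<noteq> 0"
  have bound: "real n * m\<^sup>2 \<le> 1" for n
  proof -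
    let ?Y = "\<lambda>x. \<Sum>i<n. X i x"
    have sq: "(?Y x)\<^sup>2 = (\<Sum>i<n. \<Sum>k<n. X i x * X k x)" for x
      by (simp add: power2_eq_square sum_product)
    have Y: "integrable M ?Y" "integrable M (\<lambda>x. (?Y x)\<^sup>2)"
      unfolding sq by (intro Bochner_Integration.integrable_sum int)+
    \<comment> \<open>Orthonormality and the common mean turn this expectation into
      \<open>1 - 2 * n * m^2 + n * m^2\<close>, so its nonnegativity is the bound.\<close>
    have "0 \<le> expectation (\<lambda>x. (1 - m * ?Y x)\<^sup>2)"
      by simp
    also have "\<dots> = expectation (\<lambda>x. 1 - 2 * m * ?Y x + m\<^sup>2 * (?Y x)\<^sup>2)"
      by (simp add: power2_diff power_mult_distrib algebra_simps)
    also have "\<dots> = 1 - 2 * m * expectation ?Y + m\<^sup>2 * expectation (\<lambda>x. (?Y x)\<^sup>2)"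
      using Y by (simp add: prob_space)
    also have "expectation ?Y = n * m"
      by (simp add: Bochner_Integration.integral_sum int mean)
    also have "expectation (\<lambda>x. (?Y x)\<^sup>2) = n"
      unfolding sq by (simp add: Bochner_Integration.integral_sum int orth)
    finally show ?thesis
      by (simp add: power2_eq_square algebra_simps)
  qed
  obtain n where "1 / m\<^sup>2 < real n"
    using reals_Archimedean2 by blast
  with \<open>m \<noteq> 0\<close> bound[of n] show False
    by (simp add: field_simps)
qed

text \<open>On \<open>{-1, 1}\<close> every indicator function is affine, so the moments determine the joint law.\<close>

lemma (in prob_space) indep_var_uncorrelated_signs:
  fixes X Y :: "'a \<Rightarrow> real"
  assumes [measurable]: "X \<in> borel_measurable M" "Y \<in> borel_measurable M"
    and X: "\<And>x. x \<in> space M \<Longrightarrow> X x \<in> {-1, 1}" and Y: "\<And>x. x \<in> space M \<Longrightarrow> Y x \<in> {-1, 1}"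
    and uncorr: "expectation (\<lambda>x. X x * Y x) = expectation X * expectation Y"
  shows "indep_var borel X borel Y"
proof -
  \<comment> \<open>\<open>c A\<close> and \<open>s A\<close> are the even and odd parts of the
    indicator of \<open>A\<close> on \<open>{-1, 1}\<close>, which are its constant term and its
    slope there.\<close>
  define c :: "real set \<Rightarrow> real" where "c A = (indicator A 1 + indicator A (-1)) / 2" for A
  define s :: "real set \<Rightarrow> real" where "s A = (indicator A 1 - indicator A (-1)) / 2" for A
  have ind: "indicator A u = c A + s A * u" if "u \<in> {-1, 1}" for A u
    using that by (auto simp: c_def s_def field_simps)
  have bnd: "\<bar>X x\<bar> \<le> 1" "\<bar>Y x\<bar> \<le> 1" "\<bar>X x * Y x\<bar> \<le> 1" if "x \<in> space M" for x
    using X[OF that] Y[OF that] by auto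
  have int [simp]: "integrable M X" "integrable M Y" "integrable M (\<lambda>x. X x * Y x)"
    by (rule integrable_const_bound[where B = 1]; simp add: bnd)+
  have pX: "prob (X -` A \<inter> space M) = c A + s A * expectation X" if [measurable]: "A \<in> sets borel" for A
  proof -
    have "prob (X -` A \<inter> space M) = expectation (indicator (X -` A \<inter> space M))"
      by simp
    also have "\<dots> = expectation (\<lambda>x. c A + s A * X x)"
      using ind[OF X] by (intro Bochner_Integration.integral_cong) (auto simp: indicator_def)
    finally show ?thesis
      by (simp add: prob_space)
  qed
  have pY: "prob (Y -` A \<inter> space M) = c A + s A * expectation Y" if [measurable]: "A \<in> sets borel" for A
  proof -
    have "prob (Y -` A \<inter> space M) = expectation (indicator (Y -` A \<inter> space M))"
      by simp
    also have "\<dots> = expectation (\<lambda>x. c A + s A * Y x)"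
      using ind[OF Y] by (intro Bochner_Integration.integral_cong) (auto simp: indicator_def)
    finally show ?thesis
      by (simp add: prob_space)
  qed
  have pXY: "prob ((X -` A \<inter> space M) \<inter> (Y -` B \<inter> space M))
      = prob (X -` A \<inter> space M) * prob (Y -` B \<inter> space M)"
    if [measurable]: "A \<in> sets borel" "B \<in> sets borel" for A B
  proof -
    let ?E = "(X -` A \<inter> space M) \<inter> (Y -` B \<inter> space M)"
    have "prob ?E = expectation (indicator ?E)"
      by simp
    also have "\<dots> = expectation (\<lambda>x. (c A + s A * X x) * (c B + s B * Y x))"
      by (intro Bochner_Integration.integral_cong refl)
        (simp add: ind[OF X, symmetric] ind[OF Y, symmetric] indicator_def of_bool_conj)
    also have "\<dots> = expectation (\<lambda>x. c A * c B + (c A * s B) * Y x + (s A * c B) * X x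
        + (s A * s B) * (X x * Y x))"
      by (simp add: algebra_simps)
    also have "\<dots> = c A * c B + (c A * s B) * expectation Y + (s A * c B) * expectation X
        + (s A * s B) * (expectation X * expectation Y)"
      by (simp add: prob_space uncorr)
    also have "\<dots> = (c A + s A * expectation X) * (c B + s B * expectation Y)"
      by (simp add: algebra_simps)
    finally show ?thesis
      by (simp add: pX pY)
  qed
  \<comment> \<open>Independence of the generated sigma-algebras follows from the product formula on
    generators that are closed under intersection.\<close>
  have stable: "Int_stable {Z -` A \<inter> space M |A. A \<in> sets borel}" for Z :: "'a \<Rightarrow> real"
  proof (safe intro!: Int_stableI)
    fix A B :: "real set" assume "A \<in> sets borel" "B \<in> sets borel"
    then show "\<exists>C. (Z -` A \<inter> space M) \<inter> (Z -` B \<inter> space M) = Z -` C \<inter> space M \<and> C \<in> sets borel"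
      by (intro exI[of _ "A \<inter> B"]) auto
  qed
  show ?thesis
    unfolding indep_var_eq
    by (intro conjI indep_set_sigma_sets stable indep_setI) (auto simp: pXY)
qed

section \<open>Independence of the coordinates\<close>

theorem theorem6p1:
  fixes \<epsilon> :: "nat \<Rightarrow> real" and \<mu> :: "(nat \<Rightarrow> real) measure"
  assumes "\<And>j. \<epsilon> j \<in> {-1, 1}"
    and "square_L2_flat (sign_poly \<epsilon>)"
    and "seq_limit_point (weak_star_topology (orbit_closure \<epsilon>)) (empirical_measure \<epsilon>) \<mu>"
  shows "pairwise (\<lambda>i k. prob_space.indep_var \<mu> borel (\<lambda>x. x i) borel (\<lambda>x. x k)) UNIV"
proof -
  have "\<mu> \<in> borel_probabilities (orbit_closure \<epsilon>)"
    using assms(3)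
    by (simp add: seq_limit_point_def weak_star_topology_def Let_def topspace_pullback_topology)
  then have ps: "prob_space \<mu>" and sets: "sets \<mu> = sets (restrict_space borel (orbit_closure \<epsilon>))"
    by (auto simp: borel_probabilities_def borel_on_def)
  interpret prob_space \<mu> by (rule ps)
  note limit = integral_empirical_limit[OF assms(3)]
  have space: "space \<mu> = orbit_closure \<epsilon>"
    using sets_eq_imp_space_eq[OF sets] by (simp add: space_restrict_space)
  have signs: "x i \<in> {-1, 1}" if "x \<in> space \<mu>" for x i
    using orbit_closure_values[of \<epsilon>, OF assms(1) that[unfolded space]] .
  have coord: "continuous_on UNIV (\<lambda>x :: nat \<Rightarrow> real. x i)" for i
    by (rule continuous_on_product_coordinates)
  have meas [measurable]: "(\<lambda>x. x i) \<in> borel_measurable \<mu>" for i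
    using borel_measurable_continuous_on_restrict[OF continuous_on_subset[OF coord subset_UNIV]]
    by (simp add: measurable_cong_sets[OF sets refl])
  have bnd: "\<bar>x i\<bar> \<le> 1" "\<bar>x i * x k\<bar> \<le> 1" if "x \<in> space \<mu>" for x i k
    using signs[OF that, of i] signs[OF that, of k] by auto
  have int: "integrable \<mu> (\<lambda>x. x i)" "integrable \<mu> (\<lambda>x. x i * x k)" for i k
    by (rule integrable_const_bound[where B = 1]; simp add: bnd)+
  have less: "expectation (\<lambda>x. x i * x k) = 0" if "i < k" for i k
    using flat_shifted_correlation_tendsto[OF assms(1,2) that]
    by (intro limit continuous_intros coord) (simp add: left_shift_funpow)
  have "expectation (\<lambda>x. x i * x i) = 1" for i
  proof -
    have "x i * x i = 1" if "x \<in> space \<mu>" for x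
      using signs[OF that, of i] by auto
    then show ?thesis
      by (simp add: prob_space cong: Bochner_Integration.integral_cong)
  qed
  then have orth: "expectation (\<lambda>x. x i * x k) = (if i = k then 1 else 0)" for i k
    using less[of i k] less[of k i] by (cases i k rule: linorder_cases) (auto simp: mult.commute)
  \<comment> \<open>Only this trace of shift invariance is needed: neighbouring coordinates have
    equal means.\<close>
  have "expectation (\<lambda>x. x i - x (Suc i)) = 0" for i
    using shift_average_tendsto[OF assms(1)]
    by (intro limit continuous_intros coord) (simp add: left_shift_funpow)
  then have "expectation (\<lambda>x. x (Suc i)) = expectation (\<lambda>x. x i)" for i
    by (simp add: int)
  then have const: "expectation (\<lambda>x. x i) = expectation (\<lambda>x. x 0)" for i
    by (induction i) auto
  have "expectation (\<lambda>x. x 0) = 0"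
    by (rule orthonormal_common_mean_zero[where X = "\<lambda>i x. x i", OF int orth const])
  then have "expectation (\<lambda>x. x i) = 0" for i
    using const by simp
  \<comment> \<open>For distinct indices the mixed moment is 0, and so is the product of the
    means.\<close>
  then show ?thesis
    by (intro pairwiseI indep_var_uncorrelated_signs meas signs) (auto simp: orth)
qed

end
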